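(* Let $1\le i\le k$ and let $\alpha_{i,n}$ be an arbitrary positive real number. The cdf $H_{AS,n,\theta,\sigma}^i$ of $\sigma^{-1}\alpha_{i,n}(\hat\theta_{AS,i}-\theta_i)$ under $P_{n,\theta,\sigma}$ is given by $$H_{AS,n,\theta,\sigma}^i(x)=\Phi\left(z_{n,\theta,\sigma}^{(2)}(x,\eta_{i,n})\right)\mathbf{1}\left(\alpha_{i,n}^{-1}x+\theta_i/\sigma\ge0\right)+\Phi\left(z_{n,\theta,\sigma}^{(1)}(x,\eta_{i,n})\right)\mathbf{1}\left(\alpha_{i,n}^{-1}x+\theta_i/\sigma<0\right),$$ where $z_{n,\theta,\sigma}^{(1)}(x,y)\le z_{n,\theta,\sigma}^{(2)}(x,y)$ are defined by $$0.5n^{1/2}\xi_{i,n}^{-1}(\alpha_{i,n}^{-1}x-\theta_i/\sigma)\pm n^{1/2}\sqrt{\left(0.5\xi_{i,n}^{-1}(\alpha_{i,n}^{-1}x+\theta_i/\sigma)\right)^2+y^2}.$$ Or, equivalently, the corresponding measure is $$dH_{AS,n,\theta,\sigma}^i(x)=\left\{\Phi\left(n^{1/2}(-\theta_i/(\sigma\xi_{i,n})+\eta_{i,n})\right)-\Phi\left(n^{1/2}(-\theta_i/(\sigma\xi_{i,n})-\eta_{i,n})\right)\right\}d\delta_{-\alpha_{i,n}\theta_i/\sigma}(x)$$ $$+\left(0.5n^{1/2}/(\alpha_{i,n}\xi_{i,n})\right)\Big\{\phi\left(z_{n,\theta,\sigma}^{(2)}(x,\eta_{i,n})\right)(1+t_{n,\theta,\sigma}(x,\eta_{i,n}))\mathbf{1}\left(\alpha_{i,n}^{-1}x+\theta_i/\sigma>0\right)$$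 $$\qquad+\,\phi\left(z_{n,\theta,\sigma}^{(1)}(x,\eta_{i,n})\right)(1-t_{n,\theta,\sigma}(x,\eta_{i,n}))\mathbf{1}\left(\alpha_{i,n}^{-1}x+\theta_i/\sigma<0\right)\Big\}dx,$$ where $t_{n,\theta,\sigma}(x,y)=0.5\xi_{i,n}^{-1}(\alpha_{i,n}^{-1}x+\theta_i/\sigma)\big/\left((0.5\xi_{i,n}^{-1}(\alpha_{i,n}^{-1}x+\theta_i/\sigma))^2+y^2\right)^{1/2}$ and $\delta_z$ denotes pointmass at $z$.
   Context: Consider the linear regression model $Y=X\theta+u$, where $X$ is a nonstochastic $n\times k$ matrix of rank $k\ge1$ ($n\ge k$), $\theta\in\mathbb{R}^k$, $u\sim N(0,\sigma^2I_n)$, $0<\sigma<\infty$; $P_{n,\theta,\sigma}$ denotes probability under parameters $\theta,\sigma$. $X'$ is the transpose of $X$. $\xi_{i,n}$ is the nonnegative square root of the $i$-th diagonal element of $(X'X/n)^{-1}$. $\hat\theta_{LS}=(X'X)^{-1}X'Y$ with $i$-th component $\hat\theta_{LS,i}$. The tuning parameter $\eta_{i,n}$ is a positive real number. The infeasible (known-variance) adaptive soft-thresholding estimator is $\hat\theta_{AS,i}=\hat\theta_{LS,i}(1-\sigma^2\xi_{i,n}^2\eta_{i,n}^2/\hat\theta_{LS,i}^2)_+$, i.e. $0$ if $|\hat\theta_{LS,i}|\le\sigma\xi_{i,n}\eta_{i,n}$ and $\hat\theta_{LS,i}-\sigma^2\xi_{i,n}^2\eta_{i,n}^2/\hat\theta_{LS,i}$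 otherwise. $\Phi,\phi$ are the standard normal cdf and pdf. *)

theory Defs
  imports "HOL-Probability.Probability"
begin

definition Phi :: "real \<Rightarrow> real"
  where "Phi x = cdf std_normal_distribution x"

text \<open>Lebesgue density of \<open>N(0, \<sigma>\<^sup>2 I\<^sub>n)\<close>, where \<open>n = CARD('n)\<close>.\<close>

definition iso_normal_density :: "real \<Rightarrow> real ^ 'n \<Rightarrow> real"
  where "iso_normal_density \<sigma> v =
    (1 / sqrt (2 * pi * \<sigma>\<^sup>2)) ^ CARD('n) * exp (- (norm v)\<^sup>2 / (2 * \<sigma>\<^sup>2))"

text \<open>The matrix type \<^typ>\<open>real ^ 'k ^ 'n\<close> has \<open>n = CARD('n)\<close> rows and \<open>k = CARD('k)\<close> columns.\<close>

definition xi :: "real ^ 'k ^ 'n \<Rightarrow> 'k \<Rightarrow> real"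
  where "xi X i = sqrt (matrix_inv ((1 / real CARD('n)) *\<^sub>R (transpose X ** X)) $ i $ i)"

definition theta_LS :: "real ^ 'k ^ 'n \<Rightarrow> real ^ 'n \<Rightarrow> real ^ 'k"
  where "theta_LS X y = matrix_inv (transpose X ** X) *v (transpose X *v y)"

text \<open>If the least-squares component is \<open>0\<close>, the quotient below is \<open>0\<close> by convention and
  the outer factor makes the estimator \<open>0\<close>, as it should be.\<close>

definition theta_AS :: "real ^ 'k ^ 'n \<Rightarrow> real \<Rightarrow> real \<Rightarrow> 'k \<Rightarrow> real ^ 'n \<Rightarrow> real"
  where "theta_AS X \<sigma> \<eta> i y =
    theta_LS X y $ i * max 0 (1 - \<sigma>\<^sup>2 * (xi X i)\<^sup>2 * \<eta>\<^sup>2 / (theta_LS X y $ i)\<^sup>2)"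

lemma theta_AS_cases:
  assumes "0 \<le> \<sigma> * xi X i * \<eta>"
  shows "theta_AS X \<sigma> \<eta> i y =
    (if \<bar>theta_LS X y $ i\<bar> \<le> \<sigma> * xi X i * \<eta> then 0
     else theta_LS X y $ i - \<sigma>\<^sup>2 * (xi X i)\<^sup>2 * \<eta>\<^sup>2 / theta_LS X y $ i)"
proof (cases "theta_LS X y $ i = 0")
  case True
  then show ?thesis using assms by (simp add: theta_AS_def)
next
  case False
  define a where "a = theta_LS X y $ i"
  define c where "c = \<sigma> * xi X i * \<eta>"
  have "a \<noteq> 0" "0 \<le> c" using False assms by (simp_all add: a_def c_def)
  have "\<bar>a\<bar> \<le> c \<longleftrightarrow> a\<^sup>2 \<le> c\<^sup>2"
    using \<open>0 \<le> c\<close> by (simp add: abs_le_square_iff[symmetric])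
  also have "\<dots> \<longleftrightarrow> 1 - c\<^sup>2 / a\<^sup>2 \<le> 0"
    using \<open>a \<noteq> 0\<close> by (simp add: field_simps)
  finally have "a * max 0 (1 - c\<^sup>2 / a\<^sup>2) = (if \<bar>a\<bar> \<le> c then 0 else a - c\<^sup>2 / a)"
    using \<open>a \<noteq> 0\<close> by (simp add: max_def power2_eq_square field_simps)
  then show ?thesis
    by (simp add: theta_AS_def a_def c_def power_mult_distrib)
qed

text \<open>In the following, \<open>n\<close> is the sample size, \<open>\<xi>\<close> stands for \<open>\<xi>\<^sub>i\<^sub>,\<^sub>n\<close>, \<open>\<alpha>\<close> for the scaling factor
  and \<open>\<theta>\<^sub>i\<close> for the \<open>i\<close>-th component of the parameter.\<close>

definition z1 :: "nat \<Rightarrow> real \<Rightarrow> real \<Rightarrow> real \<Rightarrow> real \<Rightarrow> real \<Rightarrow> real \<Rightarrow> real"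
  where "z1 n \<xi> \<alpha> \<theta>\<^sub>i \<sigma> x y =
    0.5 * sqrt (real n) * inverse \<xi> * (inverse \<alpha> * x - \<theta>\<^sub>i / \<sigma>)
    - sqrt (real n) * sqrt ((0.5 * inverse \<xi> * (inverse \<alpha> * x + \<theta>\<^sub>i / \<sigma>))\<^sup>2 + y\<^sup>2)"

definition z2 :: "nat \<Rightarrow> real \<Rightarrow> real \<Rightarrow> real \<Rightarrow> real \<Rightarrow> real \<Rightarrow> real \<Rightarrow> real"
  where "z2 n \<xi> \<alpha> \<theta>\<^sub>i \<sigma> x y =
    0.5 * sqrt (real n) * inverse \<xi> * (inverse \<alpha> * x - \<theta>\<^sub>i / \<sigma>)
    + sqrt (real n) * sqrt ((0.5 * inverse \<xi> * (inverse \<alpha> * x + \<theta>\<^sub>i / \<sigma>))\<^sup>2 + y\<^sup>2)"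

definition tfun :: "real \<Rightarrow> real \<Rightarrow> real \<Rightarrow> real \<Rightarrow> real \<Rightarrow> real \<Rightarrow> real"
  where "tfun \<xi> \<alpha> \<theta>\<^sub>i \<sigma> x y =
    0.5 * inverse \<xi> * (inverse \<alpha> * x + \<theta>\<^sub>i / \<sigma>)
    / sqrt ((0.5 * inverse \<xi> * (inverse \<alpha> * x + \<theta>\<^sub>i / \<sigma>))\<^sup>2 + y\<^sup>2)"

lemma z1_le_z2: "z1 n \<xi> \<alpha> \<theta>\<^sub>i \<sigma> x y \<le> z2 n \<xi> \<alpha> \<theta>\<^sub>i \<sigma> x y"
proof -
  have "0 \<le> sqrt (real n) * sqrt ((0.5 * inverse \<xi> * (inverse \<alpha> * x + \<theta>\<^sub>i / \<sigma>))\<^sup>2 + y\<^sup>2)"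
    by simp
  then show ?thesis unfolding z1_def z2_def by linarith
qed

definition H_AS :: "'a measure \<Rightarrow> real ^ 'k ^ 'n \<Rightarrow> ('a \<Rightarrow> real ^ 'n) \<Rightarrow> real ^ 'k \<Rightarrow> real \<Rightarrow> real
    \<Rightarrow> real \<Rightarrow> 'k \<Rightarrow> real measure"
  where "H_AS P X Y \<theta> \<sigma> \<eta> \<alpha> i =
    distr P borel (\<lambda>\<omega>. inverse \<sigma> * \<alpha> * (theta_AS X \<sigma> \<eta> i (Y \<omega>) - \<theta> $ i))"

end

theory Submission
  imports Defs
begin

text \<open>
  The least-squares component is \<open>\<theta>\<^sub>i + a \<bullet> u\<close>, where \<open>a\<close> is the \<open>i\<close>-th row of \<open>(X'X)\<^sup>-\<^sup>1X'\<close>. The squared norm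
  of \<open>a\<close> is the \<open>i\<close>-th diagonal entry of \<open>(X'X)\<^sup>-\<^sup>1\<close>, that is \<open>\<xi>\<^sup>2 / n\<close> (\<open>norm_LS_row\<close>), and a linear
  functional of a spherical Gaussian is Gaussian (\<open>iso_normal_linear_functional\<close>). Hence
  \<open>Z = a \<bullet> u / (\<sigma> \<parallel>a\<parallel>)\<close> is standard normal, and the estimator is a fixed function of \<open>Z\<close>.

  That function is the map \<open>w \<mapsto> w - c\<^sup>2 / w\<close> outside \<open>[-c, c]\<close> and \<open>0\<close> inside, with \<open>c = \<sigma> \<xi> \<eta>\<close>. It is
  nondecreasing, and each of its lower level sets is a half-line whose end point is a root of the
  quadratic \<open>w\<^sup>2 - s w - c\<^sup>2\<close>: the larger root for \<open>s \<ge> 0\<close>, the smaller one for \<open>s < 0\<close>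
  (\<open>adaptive_soft_threshold_le_iff\<close>). After standardization the two roots are \<open>z\<^sup>(\<^sup>2\<^sup>)\<close> and \<open>z\<^sup>(\<^sup>1\<^sup>)\<close>
  (\<open>z_eq_standardized_preimage\<close>), which gives the cdf.

  For the measure, the cdf consists of two smooth branches that meet with a jump at
  \<open>x\<^sub>0 = - \<alpha> \<theta>\<^sub>i / \<sigma>\<close>, the value that corresponds to an estimate of \<open>0\<close>. Such a distribution is an atom
  of the size of the jump plus the derivatives of the branches as a density
  (\<open>emeasure_of_two_piece_cdf\<close>); the derivatives come from the chain rule.
\<close>

section \<open>Linear functionals of spherical Gaussian vectors\<close>

text \<open>If the joint density factorizes over the coordinates, then so does the probability of every box, by
  Fubini for \<open>lborel\<close>; and a law that agrees with a product measure on boxes is that product measure.\<close>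

lemma (in prob_space)
  fixes u :: "'a \<Rightarrow> 'e::euclidean_space" and g :: "'e \<Rightarrow> real \<Rightarrow> ennreal"
  assumes u: "distributed M lborel u (\<lambda>v. \<Prod>b\<in>Basis. g b (v \<bullet> b))"
    and g: "\<And>b. b \<in> Basis \<Longrightarrow> g b \<in> borel_measurable borel"
    and prob: "\<And>b. b \<in> Basis \<Longrightarrow> prob_space (density lborel (g b))"
  shows indep_vars_product_density: "indep_vars (\<lambda>_. borel) (\<lambda>b \<omega>. u \<omega> \<bullet> b) Basis"
    and distributed_product_density: "b \<in> Basis \<Longrightarrow> distributed M lborel (\<lambda>\<omega>. u \<omega> \<bullet> b) (g b)"
proof -
  \<comment> \<open>The index type is larger than \<open>Basis\<close>; point masses off \<open>Basis\<close> make every factor a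
    probability measure.\<close>
  let ?N = "\<lambda>b. if b \<in> Basis then density lborel (g b) else return lborel 0"
  let ?J = "distr M (\<Pi>\<^sub>M b\<in>Basis. borel) (\<lambda>\<omega>. \<lambda>b\<in>Basis. u \<omega> \<bullet> b)"
  have u_meas [measurable]: "u \<in> borel_measurable M"
    using u by (simp add: distributed_def)
  have N: "prob_space (?N b)" for b
    using prob by (auto intro: prob_space_return)
  interpret N: product_prob_space ?N
    by (intro product_prob_space.intro product_sigma_finite.intro product_prob_space_axioms.intro
        N prob_space_imp_sigma_finite)
  have joint: "?J = PiM Basis ?N"
  proof (rule N.PiM_eqI)
    show "sets ?J = sets (PiM Basis ?N)"
      by (simp, intro sets_PiM_cong) auto
    fix A assume "\<And>b. b \<in> Basis \<Longrightarrow> A b \<in> sets (?N b)"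
    then have A [measurable]: "\<And>b. b \<in> Basis \<Longrightarrow> A b \<in> sets borel" by auto
    note g[measurable]
    have "emeasure ?J (Pi\<^sub>E Basis A) = emeasure (distr M lborel u) {v. \<forall>b\<in>Basis. v \<bullet> b \<in> A b}"
    proof -
      have "(\<Pi>\<^sub>E b\<in>Basis. A b) \<in> sets (\<Pi>\<^sub>M b\<in>Basis. borel)"
        by (rule sets_PiM_I_finite) auto
      moreover have "{v :: 'e. \<forall>b\<in>Basis. v \<bullet> b \<in> A b} \<in> sets lborel" by measurable
      ultimately show ?thesis
        by (subst (1 2) emeasure_distr) (auto intro!: arg_cong[where f = "emeasure M"] simp: PiE_iff)
    qed
    also have "\<dots> = (\<integral>\<^sup>+ v. (\<Prod>b\<in>Basis. g b (v \<bullet> b)) * indicator {v. \<forall>b\<in>Basis. v \<bullet> b \<in> A b} v \<partial>lborel)"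
      unfolding distributed_distr_eq_density[OF u] by (subst emeasure_density) auto
    also have "\<dots> = (\<integral>\<^sup>+ v. (\<Prod>b\<in>Basis. g b (v \<bullet> b) * indicator (A b) (v \<bullet> b)) \<partial>lborel)"
      by (intro nn_integral_cong) (auto simp: prod.distrib indicator_def prod_zero_iff)
    also have "\<dots> = (\<Prod>b\<in>Basis. \<integral>\<^sup>+ x. g b x * indicator (A b) x \<partial>lborel)"
      by (rule nn_integral_lborel_prod) auto
    also have "\<dots> = (\<Prod>b\<in>Basis. emeasure (?N b) (A b))"
      by (intro prod.cong) (auto simp: emeasure_density)
    finally show "emeasure ?J (Pi\<^sub>E Basis A) = (\<Prod>b\<in>Basis. emeasure (?N b) (A b))" .
  qed simp
  have marginal: "distr M borel (\<lambda>\<omega>. u \<omega> \<bullet> b) = ?N b" if b: "b \<in> Basis" for b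
  proof -
    have "?N b = distr (PiM Basis ?N) (?N b) (\<lambda>x. x b)"
      using distr_PiM_component[of Basis ?N b, OF N b] by simp
    also have "\<dots> = distr ?J borel (\<lambda>x. x b)"
      unfolding joint using b by (intro distr_cong) auto
    also have "\<dots> = distr M borel (\<lambda>\<omega>. u \<omega> \<bullet> b)"
      using b by (subst distr_distr) (auto simp: comp_def)
    finally show ?thesis ..
  qed
  have "?J = (\<Pi>\<^sub>M b\<in>Basis. distr M borel (\<lambda>\<omega>. u \<omega> \<bullet> b))"
    unfolding joint by (intro PiM_cong) (auto simp: marginal)
  then show "indep_vars (\<lambda>_. borel) (\<lambda>b \<omega>. u \<omega> \<bullet> b) Basis"
    by (subst indep_vars_iff_distr_eq_PiM) auto
  show "distributed M lborel (\<lambda>\<omega>. u \<omega> \<bullet> b) (g b)" if "b \<in> Basis"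
    using marginal[OF that] g[OF that] that
    by (auto simp: distributed_def cong: distr_cong)
qed

lemma iso_normal_density_eq_prod:
  fixes v :: "real ^ 'n"
  assumes "0 < \<sigma>"
  shows "ennreal (iso_normal_density \<sigma> v) = (\<Prod>b\<in>Basis. ennreal (normal_density 0 \<sigma> (v \<bullet> b)))"
proof -
  have "(norm v)\<^sup>2 = (\<Sum>b\<in>Basis. (v \<bullet> b)\<^sup>2)"
    unfolding power2_norm_eq_inner by (subst euclidean_inner) (simp add: power2_eq_square)
  then have "iso_normal_density \<sigma> v = (\<Prod>b\<in>Basis. normal_density 0 \<sigma> (v \<bullet> b))"
    by (simp add: iso_normal_density_def normal_density_def prod.distrib prod_dividef
        exp_sum[symmetric] sum_negf sum_divide_distrib power_one_over)
  then show ?thesis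
    by (simp add: prod_ennreal normal_density_nonneg)
qed

text \<open>The coordinates of \<open>u\<close> are independent and normal, so \<open>a \<bullet> u\<close> is a sum of independent normal
  variables. Coordinates in which \<open>a\<close> vanishes are dropped, because the degenerate law of their
  summand has no density.\<close>

lemma (in prob_space) iso_normal_linear_functional:
  fixes u :: "'a \<Rightarrow> real ^ 'n"
  assumes u: "distributed M lborel u (\<lambda>v. ennreal (iso_normal_density \<sigma> v))"
    and \<sigma>: "0 < \<sigma>" and a: "a \<noteq> 0"
  shows "distributed M lborel (\<lambda>\<omega>. a \<bullet> u \<omega>) (\<lambda>x. ennreal (normal_density 0 (\<sigma> * norm a) x))"
proof -
  let ?I = "{b \<in> Basis. a \<bullet> b \<noteq> 0}"
  have "(\<lambda>v :: real ^ 'n. ennreal (iso_normal_density \<sigma> v)) = (\<lambda>v. \<Prod>b\<in>Basis. ennreal (normal_density 0 \<sigma> (v \<bullet> b)))"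
    by (intro ext iso_normal_density_eq_prod \<sigma>)
  with u have u': "distributed M lborel u (\<lambda>v. \<Prod>b\<in>Basis. ennreal (normal_density 0 \<sigma> (v \<bullet> b)))"
    by simp
  note coord = indep_vars_product_density[OF u' _ prob_space_normal_density[OF \<sigma>]]
    distributed_product_density[OF u' _ prob_space_normal_density[OF \<sigma>]]
  have "indep_vars (\<lambda>_. borel) (\<lambda>b \<omega>. u \<omega> \<bullet> b) ?I"
    by (rule indep_vars_subset[OF coord(1)]) auto
  then have indep: "indep_vars (\<lambda>_. borel) (\<lambda>b \<omega>. (a \<bullet> b) * (u \<omega> \<bullet> b)) ?I"
    by (rule indep_vars_compose2) simp
  have ne: "?I \<noteq> {}" using a euclidean_all_zero_iff[of a] by blast
  have marg: "distributed M lborel (\<lambda>\<omega>. (a \<bullet> b) * (u \<omega> \<bullet> b)) (normal_density 0 (\<bar>a \<bullet> b\<bar> * \<sigma>))"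
    if "b \<in> ?I" for b
    using normal_density_affine[OF coord(2)[of b] \<sigma>, of "a \<bullet> b" 0] that by simp
  have "distributed M lborel (\<lambda>\<omega>. \<Sum>b\<in>?I. (a \<bullet> b) * (u \<omega> \<bullet> b))
     (normal_density (\<Sum>b\<in>?I. 0) (sqrt (\<Sum>b\<in>?I. (\<bar>a \<bullet> b\<bar> * \<sigma>)\<^sup>2)))"
    by (rule sum_indep_normal[OF _ ne indep _ marg]) (use \<sigma> in auto)
  also have "(\<lambda>\<omega>. \<Sum>b\<in>?I. (a \<bullet> b) * (u \<omega> \<bullet> b)) = (\<lambda>\<omega>. a \<bullet> u \<omega>)"
    by (subst euclidean_inner, intro ext sum.mono_neutral_left) auto
  also have "sqrt (\<Sum>b\<in>?I. (\<bar>a \<bullet> b\<bar> * \<sigma>)\<^sup>2) = \<sigma> * norm a"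
  proof -
    have "(\<Sum>b\<in>?I. (\<bar>a \<bullet> b\<bar> * \<sigma>)\<^sup>2) = (\<Sum>b\<in>Basis. (\<bar>a \<bullet> b\<bar> * \<sigma>)\<^sup>2)"
      by (intro sum.mono_neutral_left) auto
    also have "\<dots> = (\<sigma> * norm a)\<^sup>2"
      unfolding power_mult_distrib power2_norm_eq_inner euclidean_inner[of a a]
      by (simp add: power2_eq_square sum_distrib_left mult_ac)
    finally show ?thesis using \<sigma> by simp
  qed
  finally show ?thesis by simp
qed

section \<open>The least-squares component\<close>

lemma matrix_inv_eqI:
  fixes A B :: "real ^ 'n ^ 'n"
  assumes "A ** B = mat 1"
  shows "matrix_inv A = B"
proof -
  have B: "B ** A = mat 1" using assms by (simp add: matrix_left_right_inverse)
  have "A ** matrix_inv A = mat 1"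
    unfolding matrix_inv_def using someI[of "\<lambda>C. A ** C = mat 1 \<and> C ** A = mat 1" B] assms B by blast
  then have "B ** (A ** matrix_inv A) = B" by simp
  then show ?thesis by (simp add: matrix_mul_assoc B)
qed

definition LS_row :: "real ^ 'k ^ 'n \<Rightarrow> 'k \<Rightarrow> real ^ 'n"
  where "LS_row X i = (matrix_inv (transpose X ** X) ** transpose X) $ i"

text \<open>Full column rank makes the Gram matrix injective, since \<open>v \<bullet> X'Xv = \<parallel>Xv\<parallel>\<^sup>2\<close>. Its inverse is
  symmetric because the transposed inverse is an inverse of the transposed matrix.\<close>

lemma gram_inverse:
  fixes X :: "real ^ 'k ^ 'n"
  assumes "rank X = CARD('k)"
  shows "transpose X ** X ** matrix_inv (transpose X ** X) = mat 1"
    and "matrix_inv (transpose X ** X) ** (transpose X ** X) = mat 1"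
    and "transpose (matrix_inv (transpose X ** X)) = matrix_inv (transpose X ** X)"
proof -
  let ?G = "transpose X ** X"
  have "inj ((*v) ?G)"
  proof (rule matrix_left_invertible_injective[THEN iffD1], subst matrix_left_invertible_ker, intro allI impI)
    fix v assume "?G *v v = 0"
    then have "v \<bullet> (transpose X *v (X *v v)) = 0"
      by (simp only: matrix_vector_mul_assoc inner_zero_right)
    then have "(X *v v) \<bullet> (X *v v) = 0"
      by (metis dot_lmul_matrix vector_transpose_matrix)
    then have "X *v v = 0" by simp
    then show "v = 0" using assms by (metis full_rank_injective injD matrix_vector_mult_0_right)
  qed
  then obtain B where B: "B ** ?G = mat 1" by (metis matrix_left_invertible_injective)
  then have B': "?G ** B = mat 1" by (simp add: matrix_left_right_inverse)
  have inv: "matrix_inv ?G = B" by (rule matrix_inv_eqI[OF B'])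
  show "?G ** matrix_inv ?G = mat 1" "matrix_inv ?G ** ?G = mat 1"
    unfolding inv by (fact B' B)+
  have "?G ** transpose B = mat 1"
    using arg_cong[OF B, of transpose] by (simp add: matrix_transpose_mul)
  then show "transpose (matrix_inv ?G) = matrix_inv ?G"
    using matrix_inv_eqI[of ?G] inv by metis
qed

lemma theta_LS_linear_model:
  fixes X :: "real ^ 'k ^ 'n"
  assumes "rank X = CARD('k)"
  shows "theta_LS X (X *v \<theta> + e) $ i = \<theta> $ i + LS_row X i \<bullet> e"
proof -
  let ?G = "transpose X ** X"
  have "theta_LS X (X *v \<theta> + e) = (matrix_inv ?G ** ?G) *v \<theta> + (matrix_inv ?G ** transpose X) *v e"
    unfolding theta_LS_def
    by (simp only: matrix_vector_right_distrib matrix_vector_mul_assoc matrix_mul_assoc)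
  then show ?thesis
    by (simp only: gram_inverse[OF assms] matrix_vector_mul_lid vector_add_component LS_row_def
        matrix_vector_mul_component)
qed

text \<open>With \<open>L = (X'X)\<^sup>-\<^sup>1X'\<close> one has \<open>LL' = (X'X)\<^sup>-\<^sup>1\<close>, whose diagonal holds the squared row norms of \<open>L\<close>;
  the factor \<open>\<surd>n\<close> comes from the scaling of the Gram matrix by \<open>1 / n\<close> in \<open>xi\<close>.\<close>

lemma norm_LS_row:
  fixes X :: "real ^ 'k ^ 'n"
  assumes "rank X = CARD('k)"
  shows "xi X i = sqrt (real CARD('n)) * norm (LS_row X i)"
proof -
  let ?G = "transpose X ** X" and ?n = "real CARD('n)"
  let ?L = "matrix_inv ?G ** transpose X"
  have "?L ** transpose ?L = matrix_inv ?G ** ?G ** matrix_inv ?G"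
    by (simp add: matrix_transpose_mul gram_inverse[OF assms] matrix_mul_assoc)
  then have "?L ** transpose ?L = matrix_inv ?G"
    by (simp add: gram_inverse[OF assms])
  moreover have "(?L ** transpose ?L) $ i $ i = ?L $ i \<bullet> ?L $ i"
    by (subst matrix_matrix_mult_def) (simp add: transpose_def inner_vec_def)
  ultimately have diag: "matrix_inv ?G $ i $ i = (norm (LS_row X i))\<^sup>2"
    by (simp add: LS_row_def power2_norm_eq_inner)
  have "((1 / ?n) *\<^sub>R ?G) ** (?n *\<^sub>R matrix_inv ?G) = mat 1"
    by (simp add: gram_inverse[OF assms] scalar_matrix_assoc[symmetric] matrix_scalar_ac)
  then have "matrix_inv ((1 / ?n) *\<^sub>R ?G) = ?n *\<^sub>R matrix_inv ?G"
    by (rule matrix_inv_eqI)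
  then show ?thesis by (simp add: xi_def diag real_sqrt_mult)
qed

text \<open>Since \<open>(X'X)\<^sup>-\<^sup>1X'X = I\<close>, a vanishing row of \<open>(X'X)\<^sup>-\<^sup>1X'\<close> would make a row of \<open>I\<close> vanish.\<close>

lemma LS_row_nonzero:
  fixes X :: "real ^ 'k ^ 'n"
  assumes "rank X = CARD('k)"
  shows "LS_row X i \<noteq> 0"
proof
  assume "LS_row X i = 0"
  then have "(matrix_inv (transpose X ** X) ** transpose X ** X) $ i $ i = 0"
    unfolding LS_row_def by (subst matrix_matrix_mult_def) simp
  then show False
    using gram_inverse(2)[OF assms] by (simp add: matrix_mul_assoc mat_def)
qed

section \<open>Level sets of adaptive soft-thresholding\<close>

definition adaptive_soft_threshold :: "real \<Rightarrow> real \<Rightarrow> real"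
  where "adaptive_soft_threshold c w = w * max 0 (1 - c\<^sup>2 / w\<^sup>2)"

text \<open>For \<open>\<bar>w\<bar> > c\<close>, multiplying \<open>w - c\<^sup>2 / w \<le> s\<close> by \<open>w\<close> turns it into a sign condition on
  \<open>w\<^sup>2 - s w - c\<^sup>2\<close>, whose roots have opposite signs: on \<open>w > c\<close> only the larger root matters, on
  \<open>w < -c\<close> only the smaller one. The remaining cases follow from the sign of the thresholded value,
  as the smaller root is below \<open>-c\<close> when \<open>s < 0\<close> and the larger one is at least \<open>c\<close> when \<open>s \<ge> 0\<close>.\<close>

lemma adaptive_soft_threshold_le_iff:
  assumes "0 < c"
  shows "adaptive_soft_threshold c w \<le> s \<longleftrightarrow>
    w \<le> s / 2 + (if 0 \<le> s then 1 else - 1) * sqrt ((s / 2)\<^sup>2 + c\<^sup>2)"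
proof -
  define q where "q = sqrt ((s / 2)\<^sup>2 + c\<^sup>2)"
  have q2: "q\<^sup>2 = (s / 2)\<^sup>2 + c\<^sup>2" by (simp add: q_def)
  have "sqrt ((s / 2)\<^sup>2) < q" "sqrt (c\<^sup>2) \<le> q"
    using assms unfolding q_def by (intro real_sqrt_less_mono real_sqrt_le_mono; simp)+
  then have q: "\<bar>s / 2\<bar> < q" "c \<le> q"
    using assms by (simp_all only: real_sqrt_abs abs_of_pos)
  have factor: "w\<^sup>2 - s * w - c\<^sup>2 = (w - (s / 2 + q)) * (w - (s / 2 - q))"
    using q2 by (simp add: power2_eq_square algebra_simps)
  have large: "adaptive_soft_threshold c w = w - c\<^sup>2 / w" if "c < \<bar>w\<bar>"
  proof -
    have "c\<^sup>2 \<le> w\<^sup>2" using that assms by (simp add: abs_le_square_iff[symmetric])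
    then show ?thesis
      using that assms by (auto simp: adaptive_soft_threshold_def max_def field_simps power2_eq_square)
  qed
  have small: "adaptive_soft_threshold c w = 0" if "\<bar>w\<bar> \<le> c"
  proof -
    have "w\<^sup>2 \<le> c\<^sup>2" using that assms by (simp add: abs_le_square_iff[symmetric])
    then show ?thesis
      by (cases "w = 0") (auto simp: adaptive_soft_threshold_def max_def field_simps)
  qed
  consider "c < w" | "\<bar>w\<bar> \<le> c" | "w < - c" by linarith
  then show ?thesis
  proof cases
    case 1
    then have w: "0 < w" "c * c < w * w" using assms by (auto intro: mult_strict_mono)
    have "c\<^sup>2 / w < w" using w by (simp add: divide_less_eq power2_eq_square)
    then have "0 < adaptive_soft_threshold c w" using large 1 by simp
    moreover have "adaptive_soft_threshold c w \<le> s \<longleftrightarrow> w\<^sup>2 - s * w - c\<^sup>2 \<le> 0"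
    proof -
      have "w - c\<^sup>2 / w \<le> s \<longleftrightarrow> w\<^sup>2 - s * w - c\<^sup>2 \<le> 0"
        using w by (simp add: field_simps power2_eq_square)
      then show ?thesis using large 1 by simp
    qed
    moreover have "w\<^sup>2 - s * w - c\<^sup>2 \<le> 0 \<longleftrightarrow> w \<le> s / 2 + q"
      unfolding factor using w q by (auto simp: mult_le_0_iff)
    moreover have "\<not> w \<le> s / 2 - q" using w q by linarith
    ultimately show ?thesis by (auto simp: q_def)
  next
    case 2
    have "w \<le> s / 2 + q" if "0 \<le> s" using that 2 q by linarith
    moreover have "\<not> w \<le> s / 2 - q" if "s < 0" using that 2 q by linarith
    ultimately show ?thesis using small[OF 2] by (auto simp: q_def)
  next
    case 3
    then have w: "w < 0" "c * c < (- w) * (- w)"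
      using assms mult_strict_mono[of c "- w" c "- w"] by auto
    have "w < c\<^sup>2 / w" using w by (simp add: less_divide_eq power2_eq_square)
    then have "adaptive_soft_threshold c w < 0" using large 3 by simp
    moreover have "adaptive_soft_threshold c w \<le> s \<longleftrightarrow> 0 \<le> w\<^sup>2 - s * w - c\<^sup>2"
    proof -
      have "w - c\<^sup>2 / w \<le> s \<longleftrightarrow> 0 \<le> w\<^sup>2 - s * w - c\<^sup>2"
        using w by (simp add: field_simps power2_eq_square)
      then show ?thesis using large 3 by simp
    qed
    moreover have "0 \<le> w\<^sup>2 - s * w - c\<^sup>2 \<longleftrightarrow> w \<le> s / 2 - q"
      unfolding factor using w q by (auto simp: zero_le_mult_iff)
    moreover have "w \<le> s / 2 + q" using w q by linarith
    ultimately show ?thesis by (auto simp: q_def)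
  qed
qed

text \<open>Here \<open>s\<close> is the threshold for the estimator that the event \<open>\<alpha> (estimator - \<theta>) / \<sigma> \<le> x\<close> imposes; the
  right-hand sides are the end points of the level set of the thresholding map, centred at \<open>\<theta>\<close> and
  divided by the standard deviation \<open>\<sigma> \<xi> / \<surd>n\<close> of the least-squares component.\<close>

lemma z_eq_standardized_preimage:
  fixes \<xi> \<alpha> \<theta> \<sigma> x y :: real
  assumes "0 < \<xi>" "0 < \<sigma>" "0 < n"
  defines "s \<equiv> \<sigma> * (inverse \<alpha> * x + \<theta> / \<sigma>)"
  shows "z2 n \<xi> \<alpha> \<theta> \<sigma> x y = (s / 2 + sqrt ((s / 2)\<^sup>2 + (\<sigma> * \<xi> * y)\<^sup>2) - \<theta>) / (\<sigma> * (\<xi> / sqrt (real n)))"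
    and "z1 n \<xi> \<alpha> \<theta> \<sigma> x y = (s / 2 - sqrt ((s / 2)\<^sup>2 + (\<sigma> * \<xi> * y)\<^sup>2) - \<theta>) / (\<sigma> * (\<xi> / sqrt (real n)))"
proof -
  let ?r = "0.5 * inverse \<xi> * (inverse \<alpha> * x + \<theta> / \<sigma>)"
  have "s / 2 = \<sigma> * \<xi> * ?r" using assms by (simp add: s_def)
  then have "(s / 2)\<^sup>2 + (\<sigma> * \<xi> * y)\<^sup>2 = (\<sigma> * \<xi>)\<^sup>2 * (?r\<^sup>2 + y\<^sup>2)"
    by (simp only: power_mult_distrib distrib_left[of "\<sigma>\<^sup>2 * \<xi>\<^sup>2"])
  then have root: "sqrt ((s / 2)\<^sup>2 + (\<sigma> * \<xi> * y)\<^sup>2) = \<sigma> * \<xi> * sqrt (?r\<^sup>2 + y\<^sup>2)"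
    using assms by (simp add: real_sqrt_mult)
  have lin: "s / 2 - \<theta> = \<sigma> * \<xi> * (0.5 * inverse \<xi> * (inverse \<alpha> * x - \<theta> / \<sigma>))"
    using assms by (simp add: s_def field_simps)
  have split: "(s / 2 + q - \<theta>) / (\<sigma> * (\<xi> / sqrt (real n))) = (s / 2 - \<theta>) / (\<sigma> * (\<xi> / sqrt (real n))) + q / (\<sigma> * (\<xi> / sqrt (real n)))" for q
    by (simp only: add_divide_distrib[symmetric]) (simp add: algebra_simps)
  show "z2 n \<xi> \<alpha> \<theta> \<sigma> x y = (s / 2 + sqrt ((s / 2)\<^sup>2 + (\<sigma> * \<xi> * y)\<^sup>2) - \<theta>) / (\<sigma> * (\<xi> / sqrt (real n)))"
    unfolding z2_def split root lin using assms by (simp add: field_simps)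
  show "z1 n \<xi> \<alpha> \<theta> \<sigma> x y = (s / 2 - sqrt ((s / 2)\<^sup>2 + (\<sigma> * \<xi> * y)\<^sup>2) - \<theta>) / (\<sigma> * (\<xi> / sqrt (real n)))"
    using split[of "- sqrt ((s / 2)\<^sup>2 + (\<sigma> * \<xi> * y)\<^sup>2)"]
    unfolding z1_def root lin using assms by (simp add: field_simps)
qed

section \<open>Measures with a two-branch cdf\<close>

text \<open>The left limit of the cdf at \<open>x\<^sub>0\<close> is \<open>F\<^sub>1 x\<^sub>0\<close>, so the atom there has mass \<open>F\<^sub>2 x\<^sub>0 - F\<^sub>1 x\<^sub>0\<close>. Off \<open>x\<^sub>0\<close>
  both measures are compared on the half-lines \<open>(x, \<infinity>)\<close>, where the density integrates to increments
  of \<open>F\<^sub>1\<close> and \<open>F\<^sub>2\<close>. Upper half-lines are convenient because only \<open>F\<^sub>2\<close> then needs a limit, which is \<open>1\<close>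
  for any cdf.\<close>

lemma emeasure_of_two_piece_cdf:
  fixes M :: "real measure" and F1 F2 f1 f2 :: "real \<Rightarrow> real"
  assumes M: "real_distribution M"
    and cdf: "\<And>x. cdf M x = (if x0 \<le> x then F2 x else F1 x)"
    and deriv: "\<And>x. (F1 has_real_derivative f1 x) (at x)" "\<And>x. (F2 has_real_derivative f2 x) (at x)"
    and nonneg: "\<And>x. 0 \<le> f1 x" "\<And>x. 0 \<le> f2 x"
    and [measurable]: "f1 \<in> borel_measurable borel" "f2 \<in> borel_measurable borel"
    and A: "A \<in> sets borel"
  shows "emeasure M A = ennreal (F2 x0 - F1 x0) * emeasure (return borel x0) A
    + (\<integral>\<^sup>+ x\<in>A. ennreal (f2 x * of_bool (x0 < x) + f1 x * of_bool (x < x0)) \<partial>lborel)"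
proof -
  interpret real_distribution M by fact
  let ?d = "\<lambda>x. ennreal (f2 x * of_bool (x0 < x) + f1 x * of_bool (x < x0))"
  have F1_left: "(F1 \<longlongrightarrow> F1 x0) (at_left x0)"
    using DERIV_isCont[OF deriv(1)[of x0]]
    by (simp add: continuous_within filterlim_at_split)
  moreover have "(F1 \<longlongrightarrow> prob {..<x0}) (at_left x0)"
    using cdf_at_left[of x0]
    by (rule Lim_transform_eventually) (auto simp: cdf eventually_at_filter)
  ultimately have below: "prob {..<x0} = F1 x0"
    by (intro tendsto_unique[of "at_left x0"]) auto
  have "prob {x0} = prob {..x0} - prob {..<x0}"
    by (subst finite_measure_Diff[symmetric]) (auto intro: arg_cong[where f = prob])
  then have atom: "prob {x0} = F2 x0 - F1 x0"
    using cdf[of x0] below by (simp add: cdf_def)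
  have above: "prob {x<..} = 1 - (if x0 \<le> x then F2 x else F1 x)" for x
  proof -
    have "{x<..} = space M - {..x}" by auto
    then show ?thesis using prob_compl[of "{..x}"] cdf[of x] by (simp add: cdf_def)
  qed
  have F2_le_1: "F2 x \<le> 1" if "x0 \<le> x" for x
    using cdf[of x] that cdf_bounded_prob[of x] by simp
  have F2_lim: "(F2 \<longlongrightarrow> 1) at_top"
    using cdf_lim_at_top_prob
    by (rule Lim_transform_eventually) (auto simp: cdf intro: eventually_mono[OF eventually_ge_at_top[of x0]])
  have F1_mono: "F1 x \<le> F1 y" if "x \<le> y" for x y
    using DERIV_nonneg_imp_nondecreasing[OF that, of F1] deriv nonneg by blast
  have I2: "(\<integral>\<^sup>+ t. ennreal (f2 t) * indicator {x..} t \<partial>lborel) = ennreal (1 - F2 x)" for x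
    by (rule nn_integral_FTC_atLeast[OF _ deriv(2) nonneg(2) F2_lim]) simp
  \<comment> \<open>The left-hand side is \<open>M\<close> with its atom at \<open>x\<^sub>0\<close> removed.\<close>
  have off_atom: "density M (indicator (- {x0})) = density lborel ?d"
  proof (rule measure_eqI_lessThan)
    fix x
    have "emeasure (density M (indicator (- {x0}))) {x<..} = emeasure M ({x<..} - {x0})"
      by (subst emeasure_density) (auto simp: Diff_eq Int_commute indicator_inter_arith[symmetric]
          nn_integral_indicator)
    also have "\<dots> = ennreal (prob ({x<..} - {x0}))" by (rule emeasure_eq_measure)
    finally have L: "emeasure (density M (indicator (- {x0}))) {x<..} = ennreal (prob ({x<..} - {x0}))" .
    then show "emeasure (density M (indicator (- {x0}))) {x<..} < \<infinity>" by simp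
    have R: "emeasure (density lborel ?d) {x<..} = (\<integral>\<^sup>+ t. ?d t * indicator {x<..} t \<partial>lborel)"
      by (subst emeasure_density) auto
    show "emeasure (density M (indicator (- {x0}))) {x<..} = emeasure (density lborel ?d) {x<..}"
    proof (cases "x0 \<le> x")
      case True
      have "(\<integral>\<^sup>+ t. ?d t * indicator {x<..} t \<partial>lborel) = (\<integral>\<^sup>+ t. ennreal (f2 t) * indicator {x..} t \<partial>lborel)"
        by (intro nn_integral_cong_AE, use AE_lborel_singleton[of x] in eventually_elim)
          (use True in \<open>auto split: split_indicator\<close>)
      moreover have "{x<..} - {x0} = {x<..}" using True by auto
      ultimately show ?thesis using True by (simp add: L R I2 above)
    next
      case False
      have "(\<integral>\<^sup>+ t. ?d t * indicator {x<..} t \<partial>lborel)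
          = (\<integral>\<^sup>+ t. ennreal (f1 t) * indicator {x..x0} t + ennreal (f2 t) * indicator {x0..} t \<partial>lborel)"
        by (intro nn_integral_cong_AE, use AE_lborel_singleton[of x] AE_lborel_singleton[of x0] in eventually_elim)
          (use False in \<open>auto split: split_indicator\<close>)
      also have "\<dots> = ennreal (F1 x0 - F1 x) + ennreal (1 - F2 x0)"
        using False by (subst nn_integral_add)
          (auto simp: I2 intro!: nn_integral_FTC_Icc deriv nonneg)
      also have "\<dots> = ennreal (F1 x0 - F1 x + (1 - F2 x0))"
        using False F1_mono[of x x0] F2_le_1[of x0] by (intro ennreal_plus[symmetric]) auto
      also have "F1 x0 - F1 x + (1 - F2 x0) = prob ({x<..} - {x0})"
        using False by (subst finite_measure_Diff) (auto simp: above atom)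
      finally show ?thesis by (simp add: L R)
    qed
  qed auto
  have "emeasure M A = emeasure M (A \<inter> {x0}) + emeasure M (A - {x0})"
    using A by (subst plus_emeasure) (auto intro: arg_cong[where f = "emeasure M"])
  also have "emeasure M (A - {x0}) = emeasure (density M (indicator (- {x0}))) A"
    using A by (subst emeasure_density) (auto simp: Diff_eq Int_commute indicator_inter_arith[symmetric]
          nn_integral_indicator)
  also have "\<dots> = (\<integral>\<^sup>+ x\<in>A. ?d x \<partial>lborel)"
    unfolding off_atom using A by (subst emeasure_density) auto
  also have "emeasure M (A \<inter> {x0}) = ennreal (F2 x0 - F1 x0) * emeasure (return borel x0) A"
    using A by (cases "x0 \<in> A") (simp_all add: emeasure_eq_measure atom)
  finally show ?thesis .
qed

section \<open>Derivatives of the branches\<close>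

text \<open>Continuity of the normal density and the fundamental theorem of calculus; working on
  \<open>[x - 1, x + 1]\<close> avoids an improper integral.\<close>

lemma Phi_DERIV: "(Phi has_real_derivative std_normal_density x) (at x)"
proof -
  interpret real_distribution std_normal_distribution by (rule real_dist_normal_dist)
  have cont: "continuous_on S std_normal_density" for S
    unfolding std_normal_density_def by (intro continuous_intros) simp
  have Phi_eq: "Phi y = Phi (x - 1) + integral {x - 1..y} std_normal_density" if "x - 1 \<le> y" for y
  proof -
    have "Phi y - Phi (x - 1) = measure std_normal_distribution {x - 1<..y}"
      using cdf_diff_eq[of "x - 1" y] that unfolding Phi_def by (cases "x - 1 = y") auto
    also have "\<dots> = (LINT t:{x - 1<..y}|lborel. std_normal_density t)"
    proof -
      have "measure std_normal_distribution {x - 1<..y} = integral\<^sup>L std_normal_distribution (indicator {x - 1<..y})"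
        by simp
      also have "\<dots> = (\<integral>t. std_normal_density t *\<^sub>R indicator {x - 1<..y} t \<partial>lborel)"
        by (rule integral_density) auto
      finally show ?thesis by (simp add: set_lebesgue_integral_def mult.commute)
    qed
    also have "\<dots> = integral {x - 1<..y} std_normal_density"
      by (intro set_borel_integral_eq_integral) (simp add: set_integrable_def mult.commute[of "indicator _ _"] integrable_real_mult_indicator)
    also have "\<dots> = integral {x - 1..y} std_normal_density"
      by (rule integral_spike_set) (auto intro: negligible_subset[of "{x - 1}"])
    finally show ?thesis by simp
  qed
  have "((\<lambda>y. Phi (x - 1) + integral {x - 1..y} std_normal_density) has_real_derivative std_normal_density x) (at x within {x - 1..x + 1})"
    using integral_has_real_derivative[OF cont, of x "x - 1" "x + 1"] by (auto intro!: derivative_eq_intros)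
  then have "(Phi has_real_derivative std_normal_density x) (at x within {x - 1..x + 1})"
    by (rule has_field_derivative_transform_within[where d = 1]) (auto simp: Phi_eq[symmetric])
  then show ?thesis by (simp add: at_within_Icc_at)
qed

lemma DERIV_z:
  assumes "0 < y"
  shows "((\<lambda>x. z1 n \<xi> \<alpha> \<theta> \<sigma> x y) has_real_derivative
      0.5 * sqrt (real n) / (\<alpha> * \<xi>) * (1 - tfun \<xi> \<alpha> \<theta> \<sigma> x y)) (at x)"
    and "((\<lambda>x. z2 n \<xi> \<alpha> \<theta> \<sigma> x y) has_real_derivative
      0.5 * sqrt (real n) / (\<alpha> * \<xi>) * (1 + tfun \<xi> \<alpha> \<theta> \<sigma> x y)) (at x)"
proof -
  let ?r = "\<lambda>x. 0.5 * inverse \<xi> * (inverse \<alpha> * x + \<theta> / \<sigma>)"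
  have pos: "0 < (?r x)\<^sup>2 + y\<^sup>2" using assms by (simp add: add_nonneg_pos)
  have "((\<lambda>x. (?r x)\<^sup>2 + y\<^sup>2) has_real_derivative 2 * ?r x * (0.5 * inverse \<xi> * inverse \<alpha>)) (at x)"
    by (auto intro!: derivative_eq_intros simp: algebra_simps)
  note chain = DERIV_chain2[OF DERIV_real_sqrt[OF pos] this]
  have "inverse q / 2 * (2 * r * (0.5 * inverse \<xi> * inverse \<alpha>)) = 0.5 / (\<alpha> * \<xi>) * (r / q)" for q r
    by (cases "q = 0"; cases "\<alpha> = 0"; cases "\<xi> = 0") (simp_all add: field_simps)
  with chain have root: "((\<lambda>x. sqrt ((?r x)\<^sup>2 + y\<^sup>2)) has_real_derivative
      0.5 / (\<alpha> * \<xi>) * tfun \<xi> \<alpha> \<theta> \<sigma> x y) (at x)"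
    unfolding tfun_def by (simp only:)
  have lin: "((\<lambda>x. 0.5 * sqrt (real n) * inverse \<xi> * (inverse \<alpha> * x - \<theta> / \<sigma>)) has_real_derivative
      0.5 * sqrt (real n) / (\<alpha> * \<xi>)) (at x)"
    by (rule derivative_eq_intros refl)+ (cases "\<alpha> = 0"; cases "\<xi> = 0"; simp add: field_simps)
  show "((\<lambda>x. z1 n \<xi> \<alpha> \<theta> \<sigma> x y) has_real_derivative
      0.5 * sqrt (real n) / (\<alpha> * \<xi>) * (1 - tfun \<xi> \<alpha> \<theta> \<sigma> x y)) (at x)"
    unfolding z1_def by (rule DERIV_cong[OF DERIV_diff[OF lin DERIV_cmult[OF root]]]) (simp add: diff_divide_distrib right_diff_distrib mult_ac)
  show "((\<lambda>x. z2 n \<xi> \<alpha> \<theta> \<sigma> x y) has_real_derivative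
      0.5 * sqrt (real n) / (\<alpha> * \<xi>) * (1 + tfun \<xi> \<alpha> \<theta> \<sigma> x y)) (at x)"
    unfolding z2_def by (rule DERIV_cong[OF DERIV_add[OF lin DERIV_cmult[OF root]]]) (simp add: add_divide_distrib distrib_left mult_ac)
qed

text \<open>This makes both branches of the density nonnegative.\<close>

lemma abs_tfun_le_1: "\<bar>tfun \<xi> \<alpha> \<theta> \<sigma> x y\<bar> \<le> 1"
proof -
  have "\<bar>r / sqrt (r\<^sup>2 + y\<^sup>2)\<bar> \<le> 1" for r
  proof -
    have "\<bar>r\<bar> \<le> sqrt (r\<^sup>2 + y\<^sup>2)" by (rule real_le_rsqrt) simp
    then show ?thesis by (cases "sqrt (r\<^sup>2 + y\<^sup>2) = 0") (simp_all add: divide_le_eq not_sum_power2_lt_zero)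
  qed
  then show ?thesis unfolding tfun_def .
qed

section \<open>Distribution of the adaptive soft-thresholding estimator\<close>

theorem proposition21:
  fixes P :: "'a measure"
    and X :: "real ^ 'k ^ 'n" and \<theta> :: "real ^ 'k" and \<sigma> \<eta> \<alpha> :: real and i :: 'k
    and u Y :: "'a \<Rightarrow> real ^ 'n"
  assumes "prob_space P"
    and "CARD('k) \<le> CARD('n)"
    and "rank X = CARD('k)"
    and "\<sigma> > 0"
    and "distributed P lborel u (\<lambda>v. ennreal (iso_normal_density \<sigma> v))"
    and "\<And>\<omega>. \<omega> \<in> space P \<Longrightarrow> Y \<omega> = X *v \<theta> + u \<omega>"
    and "\<eta> > 0"
    and "\<alpha> > 0"
  defines "n \<equiv> CARD('n)"
    and "\<xi> \<equiv> xi X i"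
  shows "(\<forall>x. cdf (H_AS P X Y \<theta> \<sigma> \<eta> \<alpha> i) x =
            Phi (z2 n \<xi> \<alpha> (\<theta> $ i) \<sigma> x \<eta>) * of_bool (inverse \<alpha> * x + \<theta> $ i / \<sigma> \<ge> 0)
            + Phi (z1 n \<xi> \<alpha> (\<theta> $ i) \<sigma> x \<eta>) * of_bool (inverse \<alpha> * x + \<theta> $ i / \<sigma> < 0))
    \<and> (\<forall>A \<in> sets borel. emeasure (H_AS P X Y \<theta> \<sigma> \<eta> \<alpha> i) A =
            ennreal (Phi (sqrt (real n) * (- \<theta> $ i / (\<sigma> * \<xi>) + \<eta>))
                     - Phi (sqrt (real n) * (- \<theta> $ i / (\<sigma> * \<xi>) - \<eta>)))
              * emeasure (return borel (- \<alpha> * \<theta> $ i / \<sigma>)) A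
            + (\<integral>\<^sup>+ x \<in> A. ennreal (0.5 * sqrt (real n) / (\<alpha> * \<xi>)
                * (std_normal_density (z2 n \<xi> \<alpha> (\<theta> $ i) \<sigma> x \<eta>) * (1 + tfun \<xi> \<alpha> (\<theta> $ i) \<sigma> x \<eta>)
                     * of_bool (inverse \<alpha> * x + \<theta> $ i / \<sigma> > 0)
                   + std_normal_density (z1 n \<xi> \<alpha> (\<theta> $ i) \<sigma> x \<eta>) * (1 - tfun \<xi> \<alpha> (\<theta> $ i) \<sigma> x \<eta>)
                     * of_bool (inverse \<alpha> * x + \<theta> $ i / \<sigma> < 0))) \<partial>lborel))"
proof -
  interpret prob_space P by fact
  let ?a = "LS_row X i" and ?c = "\<sigma> * \<xi> * \<eta>" and ?\<theta> = "\<theta> $ i"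
  let ?z1 = "\<lambda>x. z1 n \<xi> \<alpha> ?\<theta> \<sigma> x \<eta>" and ?z2 = "\<lambda>x. z2 n \<xi> \<alpha> ?\<theta> \<sigma> x \<eta>"
  let ?t = "\<lambda>x. tfun \<xi> \<alpha> ?\<theta> \<sigma> x \<eta>"
  let ?H = "H_AS P X Y \<theta> \<sigma> \<eta> \<alpha> i"
  define x0 where "x0 = - \<alpha> * ?\<theta> / \<sigma>"
  define Z where "Z = (\<lambda>\<omega>. ?a \<bullet> u \<omega> / (\<sigma> * norm ?a))"
  have n: "0 < n" by (simp add: n_def)
  have a: "?a \<noteq> 0" by (rule LS_row_nonzero) fact
  have \<xi>_eq: "\<xi> = sqrt (real n) * norm ?a" unfolding \<xi>_def n_def by (rule norm_LS_row) fact
  then have \<xi>: "0 < \<xi>" and norm_a: "norm ?a = \<xi> / sqrt (real n)" using a n by simp_all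
  have c: "0 < ?c" using \<xi> assms by simp
  have [measurable]: "u \<in> borel_measurable P"
    using assms(5) by (simp add: distributed_def)
  have sign: "0 \<le> inverse \<alpha> * x + ?\<theta> / \<sigma> \<longleftrightarrow> x0 \<le> x" "0 < inverse \<alpha> * x + ?\<theta> / \<sigma> \<longleftrightarrow> x0 < x"
    "inverse \<alpha> * x + ?\<theta> / \<sigma> < 0 \<longleftrightarrow> x < x0" for x
    using \<open>0 < \<alpha>\<close> \<open>0 < \<sigma>\<close> by (auto simp: x0_def field_simps)
  have "distributed P lborel (\<lambda>\<omega>. ?a \<bullet> u \<omega>) (normal_density 0 (\<sigma> * norm ?a))"
    by (rule iso_normal_linear_functional[OF assms(5) \<open>0 < \<sigma>\<close> a])
  then have "distributed P lborel Z std_normal_density"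
    using normal_standard_normal_convert[of "\<sigma> * norm ?a" "\<lambda>\<omega>. ?a \<bullet> u \<omega>" 0] a \<open>0 < \<sigma>\<close>
    by (simp add: Z_def)
  then have Z: "distr P lborel Z = std_normal_distribution" and [measurable]: "Z \<in> borel_measurable P"
    by (simp_all add: distributed_def)
  have H_eq: "?H = distr P borel (\<lambda>\<omega>. inverse \<sigma> * \<alpha> * (adaptive_soft_threshold ?c (?\<theta> + ?a \<bullet> u \<omega>) - ?\<theta>))"
    unfolding H_AS_def
    by (intro distr_cong) (simp_all add: assms(6) theta_AS_def adaptive_soft_threshold_def
        theta_LS_linear_model[OF assms(3)] power_mult_distrib \<xi>_def)
  have meas [measurable]: "(\<lambda>\<omega>. inverse \<sigma> * \<alpha> * (adaptive_soft_threshold ?c (?\<theta> + ?a \<bullet> u \<omega>) - ?\<theta>)) \<in> borel_measurable P"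
    unfolding adaptive_soft_threshold_def by measurable
  interpret H: real_distribution ?H
    unfolding H_eq by (rule real_distribution_distr) simp
  have cdf: "cdf ?H x = (if x0 \<le> x then Phi (?z2 x) else Phi (?z1 x))" for x
  proof -
    \<comment> \<open>The event that the scaled error is at most \<open>x\<close> says that the estimator is at most \<open>s\<close>.\<close>
    define s where "s = \<sigma> * (inverse \<alpha> * x + ?\<theta> / \<sigma>)"
    let ?z = "if x0 \<le> x then ?z2 x else ?z1 x"
    have s: "0 \<le> s \<longleftrightarrow> x0 \<le> x" using \<open>0 < \<sigma>\<close> by (simp add: s_def zero_le_mult_iff sign)
    have "inverse \<sigma> * \<alpha> * (v - ?\<theta>) \<le> x \<longleftrightarrow> v \<le> s" for v
    proof -
      have "\<alpha> * s = \<sigma> * x + \<alpha> * ?\<theta>"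
        using \<open>0 < \<alpha>\<close> \<open>0 < \<sigma>\<close> by (simp add: s_def field_simps)
      then have "inverse \<sigma> * \<alpha> * (v - ?\<theta>) \<le> x \<longleftrightarrow> \<alpha> * v \<le> \<alpha> * s"
        using \<open>0 < \<sigma>\<close> by (simp add: field_simps)
      then show ?thesis using \<open>0 < \<alpha>\<close> by simp
    qed
    moreover have "adaptive_soft_threshold ?c (?\<theta> + ?a \<bullet> u \<omega>) \<le> s \<longleftrightarrow> Z \<omega> \<le> ?z" for \<omega>
    proof -
      have "0 < \<sigma> * (\<xi> / sqrt (real n))" using \<xi> \<open>0 < \<sigma>\<close> n by simp
      from divide_le_cancel[of _ "\<sigma> * (\<xi> / sqrt (real n))"] this
      have "?\<theta> + v \<le> r \<longleftrightarrow> v / (\<sigma> * (\<xi> / sqrt (real n))) \<le> (r - ?\<theta>) / (\<sigma> * (\<xi> / sqrt (real n)))" for v r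
        by (simp only: le_diff_eq add.commute) auto
      then show ?thesis
        unfolding adaptive_soft_threshold_le_iff[OF c] s Z_def norm_a
          z_eq_standardized_preimage[OF \<xi> \<open>0 < \<sigma>\<close> n, of \<alpha> ?\<theta> x \<eta>, folded s_def]
        by simp
    qed
    ultimately have "cdf ?H x = measure P (Z -` {..?z} \<inter> space P)"
      unfolding cdf_def H_eq by (subst measure_distr) (auto intro!: arg_cong[where f = prob])
    also have "\<dots> = measure (distr P lborel Z) {..?z}"
      by (subst measure_distr) auto
    finally show ?thesis by (simp add: Z Phi_def cdf_def)
  qed
  \<comment> \<open>At \<open>x\<^sub>0\<close> the linear part under the root vanishes and the root is \<open>\<eta>\<close>.\<close>
  have z_x0: "?z2 x0 = sqrt (real n) * (- ?\<theta> / (\<sigma> * \<xi>) + \<eta>)" "?z1 x0 = sqrt (real n) * (- ?\<theta> / (\<sigma> * \<xi>) - \<eta>)"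
  proof -
    have r: "inverse \<alpha> * x0 = - ?\<theta> / \<sigma>" using \<open>0 < \<alpha>\<close> by (simp add: x0_def)
    show "?z2 x0 = sqrt (real n) * (- ?\<theta> / (\<sigma> * \<xi>) + \<eta>)" "?z1 x0 = sqrt (real n) * (- ?\<theta> / (\<sigma> * \<xi>) - \<eta>)"
      using \<open>0 < \<eta>\<close> \<open>0 < \<sigma>\<close> \<xi> unfolding z1_def z2_def r by (simp_all add: field_simps)
  qed
  let ?k = "0.5 * sqrt (real n) / (\<alpha> * \<xi>)"
  let ?f1 = "\<lambda>x. std_normal_density (?z1 x) * (?k * (1 - ?t x))"
  let ?f2 = "\<lambda>x. std_normal_density (?z2 x) * (?k * (1 + ?t x))"
  have [measurable]: "?z1 \<in> borel_measurable borel" "?z2 \<in> borel_measurable borel" "?t \<in> borel_measurable borel"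
    unfolding z1_def z2_def tfun_def by measurable
  have emeasure_H: "emeasure ?H A = ennreal (Phi (?z2 x0) - Phi (?z1 x0)) * emeasure (return borel x0) A
      + (\<integral>\<^sup>+ x\<in>A. ennreal (?f2 x * of_bool (x0 < x) + ?f1 x * of_bool (x < x0)) \<partial>lborel)"
    if "A \<in> sets borel" for A
  proof (rule emeasure_of_two_piece_cdf[OF H.real_distribution_axioms cdf _ _ _ _ _ _ that])
    have k: "0 \<le> ?k" using \<xi> \<open>0 < \<alpha>\<close> by simp
    have t: "0 \<le> 1 - ?t x" "0 \<le> 1 + ?t x" for x
      using abs_tfun_le_1[of \<xi> \<alpha> ?\<theta> \<sigma> x \<eta>] by (simp_all add: abs_le_iff)
    show "0 \<le> ?f1 x" "0 \<le> ?f2 x" for x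
      by (intro mult_nonneg_nonneg normal_density_nonneg k t)+
    show "((\<lambda>x. Phi (?z1 x)) has_real_derivative ?f1 x) (at x)"
      "((\<lambda>x. Phi (?z2 x)) has_real_derivative ?f2 x) (at x)" for x
      by (rule DERIV_chain2[OF Phi_DERIV] DERIV_z[OF \<open>0 < \<eta>\<close>])+
  qed measurable
  show ?thesis
  proof (intro conjI allI ballI)
    fix x
    show "cdf ?H x = Phi (?z2 x) * of_bool (inverse \<alpha> * x + ?\<theta> / \<sigma> \<ge> 0)
            + Phi (?z1 x) * of_bool (inverse \<alpha> * x + ?\<theta> / \<sigma> < 0)"
      by (simp add: cdf sign)
  next
    fix A :: "real set" assume A: "A \<in> sets borel"
    have density: "k * (p2 * t2 * o2 + p1 * t1 * o1) = p2 * (k * t2) * o2 + p1 * (k * t1) * o1"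
      for k p1 p2 t1 t2 o1 o2 :: real
      by (simp add: algebra_simps)
    show "emeasure ?H A =
            ennreal (Phi (sqrt (real n) * (- ?\<theta> / (\<sigma> * \<xi>) + \<eta>)) - Phi (sqrt (real n) * (- ?\<theta> / (\<sigma> * \<xi>) - \<eta>)))
              * emeasure (return borel (- \<alpha> * ?\<theta> / \<sigma>)) A
            + (\<integral>\<^sup>+ x \<in> A. ennreal (?k
                * (std_normal_density (?z2 x) * (1 + ?t x) * of_bool (inverse \<alpha> * x + ?\<theta> / \<sigma> > 0)
                   + std_normal_density (?z1 x) * (1 - ?t x) * of_bool (inverse \<alpha> * x + ?\<theta> / \<sigma> < 0))) \<partial>lborel)"
      using emeasure_H[OF A] unfolding sign density z_x0 x0_def[symmetric] .
  qed
qed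

end
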